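(* Under i.i.d. arrival processes with an arrival rate matrix $\boldsymbol{\lambda}=(\lambda_n^{(c)})$, let $\Lambda_{\boldsymbol{\lambda}}$ be the closure of the set of all achievable throughput vectors $(r_c)_{c\in\mathcal C}$. Then a nonnegative vector $(r_c)_{c\in\mathcal C}$ belongs to $\Lambda_{\boldsymbol{\lambda}}$ if and only if there exist flow variables $\{f_{ab}^{(c)}\ge 0 \mid c\in\mathcal C,\ (a,b)\in\mathcal L\}$ and queue overflow variables $\{q_n^{(c)}\ge 0\mid c\in\mathcal C,\ n\ne d_c\}$ such that $$\lambda_n^{(c)}+\sum_{a} f_{an}^{(c)} = q_n^{(c)}+\sum_{b} f_{nb}^{(c)}\quad \forall\, c\in\mathcal C,\ n\neq d_c,$$ $$\sum_{c} f_{ab}^{(c)}\le \mu_{\max}^{ab}\quad \forall\,(a,b)\in\mathcal L,$$ $$r_c\le \sum_{a} f_{ad_c}^{(c)}=\sum_{n}\lambda_n^{(c)}-\sum_{n} q_n^{(c)}\quad\forall\, c\in\mathcal C.$$ Here sums over $a$ (resp. $b$) in expressions $f_{an}^{(c)}$ (resp. $f_{nb}^{(c)}$) run over nodes with $(a,n)\in\mathcal L$ (resp. $(n,b)\in\mathcal L$), and sums over $n$ run over $n\ne d_c$.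
   Context: Network model. There is a finite set of nodes $\mathcal N=\{1,\dots,N\}$, a set $\mathcal L$ of directed links $(n,m)$ with $n,m\in\mathcal N$, and a finite set $\mathcal C$ of traffic classes; all class $c$ packets have the same destination node $d_c$. Time is slotted, $t=0,1,2,\dots$. In slot $t$, $A_n^{(c)}(t)\in\{0,1,\dots,A_{\max}\}$ exogenous class $c$ packets arrive at node $n$ ($A_{\max}$ a finite constant), with $A_{d_c}^{(c)}(t)=0$ for all $t$. The $A_n^{(c)}(t)$ are independent across classes $c$ and nodes $n\ne d_c$, and i.i.d. over slots with mean $\mathbb E[A_n^{(c)}(t)]=\lambda_n^{(c)}$. Each link $(n,m)$ has fixed capacity $\mu_{\max}^{nm}$ (packets/slot): a control policy allocates service rates $\mu_{nm}^{(c)}(t)\ge 0$ to class $c$ on link $(n,m)$ in slot $t$, subject to $\sum_{c}\mu_{nm}^{(c)}(t)\le\mu_{\max}^{nm}$, and at most $\mu_{nm}^{(c)}(t)$ class $c$ packets, available at node $n$, are sent over the link in the slot. Packets that have arrived at a node $n\ne d_c$ but have not been transmitted are stored in an (infinite-capacity) class $c$ queue at $n$, initially empty, and may also be discarded. Packets reaching $d_c$ leave the network. Amounts of data transmitted, stored and discarded are treated as nonnegative real numbers. Achievable throughput. Given a (causal, possibly randomized) control policy, let $F_{ab}^{(c)}(t)$ be the amount of class $c$ packets transmitted over link $(a,b)$ in the interval $[0,t]$. The throughput of class $c$ is $r_c=\liminf_{t\to\infty}\frac1t\sum_{a:(a,d_c)\in\mathcal L}\mathbb E[F_{ad_c}^{(c)}(t)]$.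 A vector $(r_c)_{c\in\mathcal C}$ is achievable if it is the throughput vector of some control policy. *)

theory Defs
  imports "HOL-Probability.Probability"
begin

text \<open>
  Nodes and traffic classes are the elements of finite types \<open>'n\<close> and \<open>'c\<close>. A slot-indexed arrival
  path is a function \<open>nat \<Rightarrow> 'n \<Rightarrow> 'c \<Rightarrow> nat\<close>; the decision maker sees its prefix up to and
  including the current slot.
\<close>

definition history :: "(nat \<Rightarrow> 'n \<Rightarrow> 'c \<Rightarrow> nat) \<Rightarrow> nat \<Rightarrow> ('n \<Rightarrow> 'c \<Rightarrow> nat) list" where
  "history x t = map x [0..<Suc t]"

text \<open>
  A policy's decisions in a slot are functions of the arrival history up to that slot (causality)
  and of a random seed, drawn from a law chosen by the policy and independent of the arrivals
  (randomization). Past decisions and queue lengths are themselves functions of these two, so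
  dependence on them need not be listed. One real-valued seed suffices, as a sequence of
  independent per-slot randomizations can be encoded in it.

  Arguments of \<open>rate\<close> and \<open>sent\<close>: history, seed, tail and head of the link, class;
  arguments of \<open>discarded\<close>: history, seed, node, class.
\<close>

record ('n, 'c) policy =
  seed :: "real measure"
  rate :: "('n \<Rightarrow> 'c \<Rightarrow> nat) list \<Rightarrow> real \<Rightarrow> 'n \<Rightarrow> 'n \<Rightarrow> 'c \<Rightarrow> real"
  sent :: "('n \<Rightarrow> 'c \<Rightarrow> nat) list \<Rightarrow> real \<Rightarrow> 'n \<Rightarrow> 'n \<Rightarrow> 'c \<Rightarrow> real"
  discarded :: "('n \<Rightarrow> 'c \<Rightarrow> nat) list \<Rightarrow> real \<Rightarrow> 'n \<Rightarrow> 'c \<Rightarrow> real"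

text \<open>
  Backlog at the beginning of slot \<open>t\<close>. Packets that arrive during slot \<open>t\<close>, exogenously or over a
  link, are available for transmission or discarding from slot \<open>t + 1\<close> on.
\<close>

primrec backlog ::
  "('n::finite \<times> 'n) set \<Rightarrow> ('c \<Rightarrow> 'n) \<Rightarrow> ('n, 'c) policy \<Rightarrow> (nat \<Rightarrow> 'n \<Rightarrow> 'c \<Rightarrow> nat) \<Rightarrow> real \<Rightarrow>
    nat \<Rightarrow> 'n \<Rightarrow> 'c \<Rightarrow> real" where
  "backlog L d p x u 0 = (\<lambda>n c. 0)"
| "backlog L d p x u (Suc t) = (\<lambda>n c.
     if n = d c then 0
     else backlog L d p x u t n c
        - (\<Sum>b | (n, b) \<in> L. sent p (history x t) u n b c)
        - discarded p (history x t) u n c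
        + real (x t n c)
        + (\<Sum>a | (a, n) \<in> L. sent p (history x t) u a n c))"

definition arrival_path ::
  "('n \<Rightarrow> 'c \<Rightarrow> nat \<Rightarrow> 'w \<Rightarrow> nat) \<Rightarrow> 'w \<Rightarrow> nat \<Rightarrow> 'n \<Rightarrow> 'c \<Rightarrow> nat" where
  "arrival_path A w t n c = A n c t w"

text \<open>
  Since the backlog at \<open>d c\<close> is \<open>0\<close>, the last condition below also says that no class \<open>c\<close> packet is
  sent out of \<open>d c\<close>. There are only countably many histories, so measurability in the seed
  for each history gives joint measurability in arrivals and seed.
\<close>

definition control_policy ::
  "('n::finite \<times> 'n) set \<Rightarrow> ('c::finite \<Rightarrow> 'n) \<Rightarrow> ('n \<Rightarrow> 'n \<Rightarrow> real) \<Rightarrow>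
    'w measure \<Rightarrow> ('n \<Rightarrow> 'c \<Rightarrow> nat \<Rightarrow> 'w \<Rightarrow> nat) \<Rightarrow> ('n, 'c) policy \<Rightarrow> bool" where
  "control_policy L d cap M A p \<longleftrightarrow>
     prob_space (seed p) \<and>
     (\<forall>h a b c. (\<lambda>u. rate p h u a b c) \<in> borel_measurable (seed p)) \<and>
     (\<forall>h a b c. (\<lambda>u. sent p h u a b c) \<in> borel_measurable (seed p)) \<and>
     (\<forall>h n c. (\<lambda>u. discarded p h u n c) \<in> borel_measurable (seed p)) \<and>
     (\<forall>w \<in> space M. \<forall>u \<in> space (seed p). \<forall>t.
        let h = history (arrival_path A w) t in
        (\<forall>(a, b) \<in> L. \<forall>c. 0 \<le> rate p h u a b c) \<and>
        (\<forall>(a, b) \<in> L. (\<Sum>c\<in>UNIV. rate p h u a b c) \<le> cap a b) \<and>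
        (\<forall>(a, b) \<in> L. \<forall>c. 0 \<le> sent p h u a b c \<and> sent p h u a b c \<le> rate p h u a b c) \<and>
        (\<forall>n c. 0 \<le> discarded p h u n c) \<and>
        (\<forall>n c. (\<Sum>b | (n, b) \<in> L. sent p h u n b c) + discarded p h u n c
                 \<le> backlog L d p (arrival_path A w) u t n c))"

definition cumulative_sent ::
  "('n \<Rightarrow> 'c \<Rightarrow> nat \<Rightarrow> 'w \<Rightarrow> nat) \<Rightarrow> ('n, 'c) policy \<Rightarrow> 'n \<Rightarrow> 'n \<Rightarrow> 'c \<Rightarrow> nat \<Rightarrow> 'w \<times> real \<Rightarrow> real" where
  "cumulative_sent A p a b c t = (\<lambda>(w, u). \<Sum>s\<le>t. sent p (history (arrival_path A w) s) u a b c)"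

definition throughput ::
  "('n::finite \<times> 'n) set \<Rightarrow> ('c \<Rightarrow> 'n) \<Rightarrow> 'w measure \<Rightarrow> ('n \<Rightarrow> 'c \<Rightarrow> nat \<Rightarrow> 'w \<Rightarrow> nat) \<Rightarrow>
    ('n, 'c) policy \<Rightarrow> 'c \<Rightarrow> ereal" where
  "throughput L d M A p c =
     liminf (\<lambda>t. ereal (1 / real t *
       (\<Sum>a | (a, d c) \<in> L. \<integral>z. cumulative_sent A p a (d c) c t z \<partial>(M \<Otimes>\<^sub>M seed p))))"

definition achievable ::
  "('n::finite \<times> 'n) set \<Rightarrow> ('c::finite \<Rightarrow> 'n) \<Rightarrow> ('n \<Rightarrow> 'n \<Rightarrow> real) \<Rightarrow>
    'w measure \<Rightarrow> ('n \<Rightarrow> 'c \<Rightarrow> nat \<Rightarrow> 'w \<Rightarrow> nat) \<Rightarrow> (real ^ 'c) set" where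
  "achievable L d cap M A =
     {r. \<exists>p. control_policy L d cap M A p \<and> (\<forall>c. ereal (r $ c) = throughput L d M A p c)}"

definition throughput_region ::
  "('n::finite \<times> 'n) set \<Rightarrow> ('c::finite \<Rightarrow> 'n) \<Rightarrow> ('n \<Rightarrow> 'n \<Rightarrow> real) \<Rightarrow>
    'w measure \<Rightarrow> ('n \<Rightarrow> 'c \<Rightarrow> nat \<Rightarrow> 'w \<Rightarrow> nat) \<Rightarrow> (real ^ 'c) set" where
  "throughput_region L d cap M A = closure (achievable L d cap M A)"

end

theory Submission
  imports Defs "HOL-Real_Asymp.Real_Asymp"
begin

text \<open>
  The flow constraints describe the achievable long-run averages, and the two directions are
  independent arguments.

  Eliminating the overflow variables turns the constraints into the existence of an
  \<^emph>\<open>admissible flow\<close>: a flow that respects the capacities, that never leaves a destination, and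
  whose outflow at any other node is at most what enters there. The last constraint of the theorem
  is where the second of these conditions comes from: summing the balance equations over
  \<open>n \<noteq> d c\<close> shows that it holds exactly if class \<open>c\<close> has no flow out of \<open>d c\<close>
  (\<open>flow_with_overflow_iff_admissible_flow\<close>).

  \<^emph>\<open>Necessity.\<close> For any policy, the expected transfers over the slots \<open>0, \<dots>, t\<close>, divided by
  \<open>t + 1\<close>, form an admissible flow, because a nonnegative backlog means that a node has not sent more
  than it has received (\<open>admissible_mean_flow\<close>). For any \<open>\<epsilon> > 0\<close> its inflow at the
  destinations is at least the throughput minus \<open>\<epsilon>\<close> once \<open>t\<close> is large. Since admissible flows vanishing off the links form
  a compact set, \<open>\<epsilon>\<close> can be sent to \<open>0\<close>, and the same limit absorbs the closure in the
  definition of the region (\<open>admissible_flow_limit\<close>).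

  \<^emph>\<open>Sufficiency.\<close> Scaling each class down, the flow \<open>f\<close> may be assumed to deliver exactly \<open>r\<close>
  (\<open>admissible_flow_scale\<close>). The policy sends \<open>f a b c\<close> on every link in every slot, reduced by a
  common factor for all links leaving a node whose backlog is too small, and discards nothing. Let
  \<open>D\<^sub>n\<close> be the sum of the missing fractions at node \<open>n\<close> up to time \<open>t\<close>. Looking at the last slot at
  which node \<open>n\<close> was short of packets gives
  \<open>outflow\<^sub>n \<cdot> D\<^sub>n \<le> (\<Sum>a. f\<^sub>a\<^sub>n \<cdot> D\<^sub>a) + const + error\<close>, where the error is the largest shortfall of the
  arrivals against their mean up to time \<open>t\<close> (\<open>outflow_deficit_le\<close>). Summed over \<open>n \<noteq> d c\<close>, all terms
  belonging to links between nondestination nodes cancel, and what is left bounds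
  \<open>\<Sum>a. f\<^sub>a\<^sub>d \<cdot> D\<^sub>a\<close>, the amount missing at the destination (\<open>delivery_lower_bound\<close>). Thus the flow may
  contain cycles: packets for circulating flow may never become available, but such deficits
  are invisible to the destination. Finally, Hoeffding's inequality and a union bound show that the
  error is below \<open>(t + 1) powr (3/4)\<close> with probability tending to \<open>1\<close>, so that the policy has
  throughput exactly \<open>r\<close> (\<open>throughput_fluid_policy\<close>).
\<close>

section \<open>Flows on a capacitated network\<close>

abbreviation outflow :: "('n::finite \<times> 'n) set \<Rightarrow> ('n \<Rightarrow> 'n \<Rightarrow> 'c \<Rightarrow> real) \<Rightarrow> 'n \<Rightarrow> 'c \<Rightarrow> real" where
  "outflow L f n c \<equiv> \<Sum>b | (n, b) \<in> L. f n b c"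

abbreviation inflow :: "('n::finite \<times> 'n) set \<Rightarrow> ('n \<Rightarrow> 'n \<Rightarrow> 'c \<Rightarrow> real) \<Rightarrow> 'n \<Rightarrow> 'c \<Rightarrow> real" where
  "inflow L f n c \<equiv> \<Sum>a | (a, n) \<in> L. f a n c"

definition admissible_flow ::
  "('n::finite \<times> 'n) set \<Rightarrow> ('c::finite \<Rightarrow> 'n) \<Rightarrow> ('n \<Rightarrow> 'n \<Rightarrow> real) \<Rightarrow> ('n \<Rightarrow> 'c \<Rightarrow> real) \<Rightarrow>
    ('n \<Rightarrow> 'n \<Rightarrow> 'c \<Rightarrow> real) \<Rightarrow> bool" where
  "admissible_flow L d cap lam f \<longleftrightarrow>
     (\<forall>(a, b) \<in> L. \<forall>c. 0 \<le> f a b c) \<and>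
     (\<forall>(a, b) \<in> L. \<forall>c. a = d c \<longrightarrow> f a b c = 0) \<and>
     (\<forall>(a, b) \<in> L. (\<Sum>c\<in>UNIV. f a b c) \<le> cap a b) \<and>
     (\<forall>c n. n \<noteq> d c \<longrightarrow> outflow L f n c \<le> lam n c + inflow L f n c)"

lemma admissible_flowD:
  assumes "admissible_flow L d cap lam f"
  shows "(a, b) \<in> L \<Longrightarrow> 0 \<le> f a b c"
    and "(d c, b) \<in> L \<Longrightarrow> f (d c) b c = 0"
    and "(a, b) \<in> L \<Longrightarrow> (\<Sum>c\<in>UNIV. f a b c) \<le> cap a b"
    and "n \<noteq> d c \<Longrightarrow> outflow L f n c \<le> lam n c + inflow L f n c"
  using assms by (auto simp: admissible_flow_def split: prod.splits)

lemma sum_outflow_eq_sum_inflow: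
  fixes L :: "('n::finite \<times> 'n) set" and g :: "'n \<Rightarrow> 'n \<Rightarrow> real"
  shows "(\<Sum>n\<in>UNIV. \<Sum>b | (n, b) \<in> L. g n b) = (\<Sum>n\<in>UNIV. \<Sum>a | (a, n) \<in> L. g a n)"
proof -
  have "(\<Sum>n\<in>UNIV. \<Sum>b | (n, b) \<in> L. g n b) = (\<Sum>n\<in>UNIV. \<Sum>b\<in>UNIV. if (n, b) \<in> L then g n b else 0)"
    by (simp flip: sum.inter_filter)
  also have "\<dots> = (\<Sum>b\<in>UNIV. \<Sum>n\<in>UNIV. if (n, b) \<in> L then g n b else 0)"
    by (rule sum.swap)
  also have "\<dots> = (\<Sum>n\<in>UNIV. \<Sum>a | (a, n) \<in> L. g a n)"
    by (simp flip: sum.inter_filter)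
  finally show ?thesis .
qed

text \<open>
  Every link joining two nodes other than \<open>z\<close> contributes to one outflow and one inflow, so in the sum of
  net supplies only the links at \<open>z\<close> survive. The weight \<open>g\<close> is arbitrary: it is used for flows as well
  as for flows weighted with the deficits of their tails.
\<close>

lemma inflow_minus_outflow_eq_net_supply:
  fixes L :: "('n::finite \<times> 'n) set" and g :: "'n \<Rightarrow> 'n \<Rightarrow> real"
  shows "(\<Sum>a | (a, z) \<in> L. g a z) - (\<Sum>b | (z, b) \<in> L. g z b) =
    (\<Sum>n | n \<noteq> z. (\<Sum>b | (n, b) \<in> L. g n b) - (\<Sum>a | (a, n) \<in> L. g a n))"
proof -
  have split: "(\<Sum>n\<in>UNIV. h n) = h z + (\<Sum>n | n \<noteq> z. h n)" for h :: "'n \<Rightarrow> real"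
  proof -
    have "UNIV - {z} = {n. n \<noteq> z}" by auto
    then show ?thesis using sum.remove[of UNIV z h] by simp
  qed
  show ?thesis
    using sum_outflow_eq_sum_inflow[where L = L and g = g]
    unfolding split[of "\<lambda>n. \<Sum>b | (n, b) \<in> L. g n b"] split[of "\<lambda>n. \<Sum>a | (a, n) \<in> L. g a n"]
    by (simp add: sum_subtractf)
qed

text \<open>
  By the balance equations, the net supply of the nodes other than \<open>d c\<close> is the total of \<open>lam - q\<close>,
  and this is the inflow minus the outflow at \<open>d c\<close>. Requiring it to equal the inflow alone
  therefore forces the outflow of class \<open>c\<close> at \<open>d c\<close>, a sum of nonnegative terms, to vanish. Conversely,
  \<open>q\<close> can be read off as the slack in the inequality at each node.
\<close>

lemma flow_with_overflow_iff_admissible_flow: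
  fixes L :: "('n::finite \<times> 'n) set" and d :: "'c::finite \<Rightarrow> 'n" and r :: "real ^ 'c"
  shows "(\<exists>(f :: 'n \<Rightarrow> 'n \<Rightarrow> 'c \<Rightarrow> real) (q :: 'n \<Rightarrow> 'c \<Rightarrow> real).
      (\<forall>c. \<forall>(a, b) \<in> L. 0 \<le> f a b c) \<and>
      (\<forall>c n. n \<noteq> d c \<longrightarrow> 0 \<le> q n c) \<and>
      (\<forall>c n. n \<noteq> d c \<longrightarrow>
         lam n c + (\<Sum>a | (a, n) \<in> L. f a n c) = q n c + (\<Sum>b | (n, b) \<in> L. f n b c)) \<and>
      (\<forall>(a, b) \<in> L. (\<Sum>c\<in>UNIV. f a b c) \<le> cap a b) \<and>
      (\<forall>c. r $ c \<le> (\<Sum>a | (a, d c) \<in> L. f a (d c) c) \<and>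
           (\<Sum>a | (a, d c) \<in> L. f a (d c) c) = (\<Sum>n | n \<noteq> d c. lam n c) - (\<Sum>n | n \<noteq> d c. q n c)))
    \<longleftrightarrow> (\<exists>f. admissible_flow L d cap lam f \<and> (\<forall>c. r $ c \<le> inflow L f (d c) c))"
    (is "(\<exists>f q. ?flows f q) \<longleftrightarrow> ?admissible")
proof
  assume "\<exists>f q. ?flows f q"
  then obtain f q where fq: "?flows f q" by blast
  from fq have nonneg: "\<And>a b c. (a, b) \<in> L \<Longrightarrow> 0 \<le> f a b c"
    and q: "\<And>n c. n \<noteq> d c \<Longrightarrow> 0 \<le> q n c"
    and bal: "\<And>n c. n \<noteq> d c \<Longrightarrow> lam n c + inflow L f n c = q n c + outflow L f n c"
    and cap: "\<And>a b. (a, b) \<in> L \<Longrightarrow> (\<Sum>c\<in>UNIV. f a b c) \<le> cap a b"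
    and r: "\<And>c. r $ c \<le> inflow L f (d c) c"
    and del: "\<And>c. inflow L f (d c) c = (\<Sum>n | n \<noteq> d c. lam n c) - (\<Sum>n | n \<noteq> d c. q n c)"
    by blast+
  have "f (d c) b c = 0" if "(d c, b) \<in> L" for b c
  proof -
    have "inflow L f (d c) c - outflow L f (d c) c =
        (\<Sum>n | n \<noteq> d c. outflow L f n c - inflow L f n c)"
      by (rule inflow_minus_outflow_eq_net_supply[where L = L and g = "\<lambda>a b. f a b c"])
    also have "\<dots> = (\<Sum>n | n \<noteq> d c. lam n c - q n c)"
    proof (rule sum.cong[OF refl])
      fix n assume "n \<in> {n. n \<noteq> d c}"
      then show "outflow L f n c - inflow L f n c = lam n c - q n c"
        using bal[of n c] by auto
    qed
    also have "\<dots> = inflow L f (d c) c"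
      by (simp add: del sum_subtractf)
    finally have "outflow L f (d c) c = 0" by simp
    then show ?thesis
      using that nonneg by (subst (asm) sum_nonneg_eq_0_iff) auto
  qed
  moreover have "outflow L f n c \<le> lam n c + inflow L f n c" if "n \<noteq> d c" for n c
    using bal[OF that] q[OF that] by simp
  ultimately have "admissible_flow L d cap lam f"
    using nonneg cap by (auto simp: admissible_flow_def)
  then show ?admissible using r by blast
next
  assume ?admissible
  then obtain f where f: "admissible_flow L d cap lam f" and r: "\<And>c. r $ c \<le> inflow L f (d c) c"
    by blast
  note fD = admissible_flowD[OF f]
  define q where "q n c = lam n c + inflow L f n c - outflow L f n c" for n c
  have del: "inflow L f (d c) c = (\<Sum>n | n \<noteq> d c. lam n c) - (\<Sum>n | n \<noteq> d c. q n c)" for c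
  proof -
    have "outflow L f (d c) c = 0"
      using fD(2) by (intro sum.neutral) auto
    then have "inflow L f (d c) c = (\<Sum>n | n \<noteq> d c. outflow L f n c - inflow L f n c)"
      using inflow_minus_outflow_eq_net_supply[where L = L and z = "d c" and g = "\<lambda>a b. f a b c"] by simp
    then show ?thesis
      by (simp add: q_def sum_subtractf sum.distrib)
  qed
  have "0 \<le> q n c" if "n \<noteq> d c" for n c
    using fD(4)[OF that] by (simp add: q_def)
  then show "\<exists>f q. ?flows f q"
    using fD(1,3) r del by (intro exI[of _ f] exI[of _ q]) (auto simp: q_def)
qed

text \<open>
  All constraints are closed conditions on the link values, and \<open>0 \<le> f a b c \<le> cap a b\<close> confines
  these values to a box, so the approximating flows have a limit point.
\<close>

lemma admissible_flow_limit:
  fixes L :: "('n::finite \<times> 'n) set" and d :: "'c::finite \<Rightarrow> 'n"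
  assumes approx: "\<And>e. 0 < e \<Longrightarrow>
    \<exists>f. admissible_flow L d cap lam f \<and> (\<forall>c. r c - e \<le> inflow L f (d c) c)"
  shows "\<exists>f. admissible_flow L d cap lam f \<and> (\<forall>c. r c \<le> inflow L f (d c) c)"
proof -
  have "\<forall>k. \<exists>f. admissible_flow L d cap lam f \<and> (\<forall>c. r c - 1 / real (Suc k) \<le> inflow L f (d c) c)"
    by (intro allI approx) simp
  then obtain F where F: "\<And>k. admissible_flow L d cap lam (F k)"
    and rF: "\<And>k c. r c - 1 / real (Suc k) \<le> inflow L (F k) (d c) c"
    by metis
  note FD = admissible_flowD[OF F]
  \<comment> \<open>Values off the links are unconstrained; setting them to 0 makes the sequence bounded.\<close>
  define v :: "nat \<Rightarrow> real ^ ('n \<times> 'n \<times> 'c)" where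
    "v k = (\<chi> i. case i of (a, b, c) \<Rightarrow> if (a, b) \<in> L then F k a b c else 0)" for k
  define u :: "real ^ ('n \<times> 'n \<times> 'c)" where
    "u = (\<chi> i. case i of (a, b, c) \<Rightarrow> max 0 (cap a b))"
  have le_cap: "F k a b c \<le> cap a b" if "(a, b) \<in> L" for k a b c
    using member_le_sum[of c UNIV "F k a b"] FD(1,3)[OF that, of k] by (simp add: order_trans)
  have cap_nonneg: "0 \<le> cap a b" if "(a, b) \<in> L" for a b
    using FD(1)[OF that] le_cap[OF that] by (meson order_trans)
  have "v k \<in> cbox 0 u" for k
    using FD(1) le_cap cap_nonneg by (auto simp: mem_box_cart v_def u_def max_def)
  then obtain l s where s: "strict_mono s" and lim: "(v \<circ> s) \<longlonglongrightarrow> l"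
    using compact_imp_seq_compact[OF compact_cbox, of 0 u] by (auto elim!: seq_compactE)
  define f where "f a b c = l $ (a, b, c)" for a b c
  have conv: "(\<lambda>k. F (s k) a b c) \<longlonglongrightarrow> f a b c" if "(a, b) \<in> L" for a b c
    using tendsto_vec_nth[OF lim, of "(a, b, c)"] that by (simp add: f_def v_def)
  have conv_in: "(\<lambda>k. inflow L (F (s k)) n c) \<longlonglongrightarrow> inflow L f n c" for n c
    by (intro tendsto_sum conv) auto
  have conv_out: "(\<lambda>k. outflow L (F (s k)) n c) \<longlonglongrightarrow> outflow L f n c" for n c
    by (intro tendsto_sum conv) auto
  have "0 \<le> f a b c" if "(a, b) \<in> L" for a b c
    by (rule LIMSEQ_le_const[OF conv[OF that]]) (use FD(1)[OF that] in auto)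
  moreover have "f (d c) b c = 0" if "(d c, b) \<in> L" for b c
    using conv[OF that, of c] FD(2)[OF that] by (simp add: LIMSEQ_const_iff)
  moreover have "(\<Sum>c\<in>UNIV. f a b c) \<le> cap a b" if "(a, b) \<in> L" for a b
    by (rule LIMSEQ_le_const2[OF tendsto_sum[OF conv[OF that]]]) (use FD(3)[OF that] in auto)
  moreover have "outflow L f n c \<le> lam n c + inflow L f n c" if "n \<noteq> d c" for n c
    by (rule LIMSEQ_le[OF conv_out tendsto_add[OF tendsto_const conv_in]])
      (use FD(4)[OF that] in auto)
  moreover have "r c \<le> inflow L f (d c) c" for c
  proof -
    have "(\<lambda>k. r c - 1 / real (Suc k)) \<longlonglongrightarrow> r c - 0"
      by (intro tendsto_diff tendsto_const LIMSEQ_Suc[OF lim_1_over_n])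
    then have "(\<lambda>k. r c - 1 / real (Suc (s k))) \<longlonglongrightarrow> r c"
      using LIMSEQ_subseq_LIMSEQ[OF _ s] by (fastforce simp: o_def)
    then show ?thesis
      by (rule LIMSEQ_le[OF _ conv_in]) (use rF in auto)
  qed
  ultimately show ?thesis
    by (intro exI[of _ f]) (auto simp: admissible_flow_def)
qed

text \<open>
  Scaling class \<open>c\<close> by \<open>s c \<in> {0..1}\<close> preserves admissibility because the supply \<open>lam\<close> is nonnegative:
  the scaled inequality at a node only needs \<open>s c * lam n c\<close>.
\<close>

lemma admissible_flow_scale:
  fixes L :: "('n::finite \<times> 'n) set" and d :: "'c::finite \<Rightarrow> 'n"
  assumes f: "admissible_flow L d cap lam f"
    and lam: "\<And>n c. 0 \<le> lam n c"
    and r: "\<And>c. 0 \<le> r c" "\<And>c. r c \<le> inflow L f (d c) c"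
  obtains g where "admissible_flow L d cap lam g" "\<And>c. inflow L g (d c) c = r c"
proof -
  note fD = admissible_flowD[OF f]
  \<comment> \<open>If the inflow is 0, then so is \<open>r c\<close>, and the factor is 0 by the convention for division.\<close>
  define s where "s c = r c / inflow L f (d c) c" for c
  have nn: "0 \<le> inflow L f n c" for n c
    using fD(1) by (intro sum_nonneg) auto
  have s: "0 \<le> s c" "s c \<le> 1" for c
    using r(1,2)[of c] nn[of "d c" c] by (auto simp: s_def divide_le_eq_1)
  define g where "g a b c = s c * f a b c" for a b c
  have in_g: "inflow L g n c = s c * inflow L f n c" for n c
    by (simp add: g_def sum_distrib_left)
  have out_g: "outflow L g n c = s c * outflow L f n c" for n c
    by (simp add: g_def sum_distrib_left)
  have "(\<Sum>c\<in>UNIV. g a b c) \<le> cap a b" if "(a, b) \<in> L" for a b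
  proof -
    have "(\<Sum>c\<in>UNIV. g a b c) \<le> (\<Sum>c\<in>UNIV. f a b c)"
      unfolding g_def using s fD(1)[OF that] by (intro sum_mono) (simp add: mult_left_le_one_le)
    then show ?thesis using fD(3)[OF that] by simp
  qed
  moreover have "outflow L g n c \<le> lam n c + inflow L g n c" if "n \<noteq> d c" for n c
  proof -
    have "outflow L g n c \<le> s c * (lam n c + inflow L f n c)"
      unfolding out_g using fD(4)[OF that] s(1) by (rule mult_left_mono)
    also have "\<dots> \<le> lam n c + inflow L g n c"
      using mult_left_le_one_le[of "lam n c" "s c"] lam s by (simp add: in_g algebra_simps)
    finally show ?thesis .
  qed
  ultimately have "admissible_flow L d cap lam g"
    using fD(1,2) s by (auto simp: admissible_flow_def g_def)
  moreover have "inflow L g (d c) c = r c" for c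
    using r(1,2)[of c] by (cases "inflow L f (d c) c = 0") (auto simp: in_g s_def)
  ultimately show ?thesis by (rule that)
qed

section \<open>Bounded independent arrivals\<close>

locale bounded_independent_arrivals = prob_space M
  for M :: "'w measure" +
  fixes A :: "'n::finite \<Rightarrow> 'c::finite \<Rightarrow> nat \<Rightarrow> 'w \<Rightarrow> nat"
    and d :: "'c \<Rightarrow> 'n" and Amax :: nat and lam :: "'n \<Rightarrow> 'c \<Rightarrow> real"
  assumes arrival_le: "w \<in> space M \<Longrightarrow> A n c t w \<le> Amax"
    and arrival_at_destination: "w \<in> space M \<Longrightarrow> A (d c) c t w = 0"
    and indep_arrivals: "indep_vars (\<lambda>_. count_space UNIV) (\<lambda>(n, c, t). A n c t) {(n, c, t). n \<noteq> d c}"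
    and expectation_arrival: "expectation (\<lambda>w. real (A n c t w)) = lam n c"
begin

lemma measurable_arrival [measurable]: "A n c t \<in> measurable M (count_space UNIV)"
proof (cases "n = d c")
  case True
  then show ?thesis
    using arrival_at_destination by (subst measurable_cong[where g = "\<lambda>_. 0"]) auto
next
  case False
  have "\<forall>i \<in> {(n, c, t). n \<noteq> d c}. (\<lambda>(n, c, t). A n c t) i \<in> measurable M (count_space UNIV)"
    using indep_arrivals unfolding indep_vars_def by simp
  from bspec[OF this, of "(n, c, t)"] False show ?thesis by simp
qed

lemma lam_nonneg: "0 \<le> lam n c"
  unfolding expectation_arrival[of n c 0, symmetric] by (rule integral_nonneg_AE) simp

text \<open>
  Histories range over a countable type, so it is enough that each single history is an event.
\<close>

lemma measurable_history [measurable]: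
  "(\<lambda>w. history (arrival_path A w) t) \<in> measurable M (count_space UNIV)"
proof (subst measurable_count_space_eq2_countable, intro conjI ballI)
  fix h :: "('n \<Rightarrow> 'c \<Rightarrow> nat) list"
  show "(\<lambda>w. history (arrival_path A w) t) -` {h} \<inter> space M \<in> sets M"
  proof (cases "length h = Suc t")
    case True
    have "(\<lambda>w. history (arrival_path A w) t) -` {h} \<inter> space M =
        {w \<in> space M. \<forall>s\<in>{..t}. \<forall>n c. A n c s w = (h ! s) n c}"
      using True
      by (auto simp: history_def arrival_path_def list_eq_iff_nth_eq fun_eq_iff less_Suc_eq_le
          simp del: upt_Suc)
    also have "\<dots> \<in> sets M" by measurable
    finally show ?thesis .
  next
    case False
    then have "(\<lambda>w. history (arrival_path A w) t) -` {h} \<inter> space M = {}"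
      by (auto simp: history_def)
    then show ?thesis by simp
  qed
qed auto

lemma integral_fst_pair:
  fixes g :: "'w \<Rightarrow> real"
  assumes "prob_space N" "g \<in> borel_measurable M"
  shows "(\<integral>z. g (fst z) \<partial>(M \<Otimes>\<^sub>M N)) = (\<integral>w. g w \<partial>M)"
proof -
  have "(\<integral>z. g (fst z) \<partial>(M \<Otimes>\<^sub>M N)) = (\<integral>w. g w \<partial>(distr (M \<Otimes>\<^sub>M N) M fst))"
    using assms(2) by (subst integral_distr) auto
  also have "distr (M \<Otimes>\<^sub>M N) M fst = M"
    by (rule prob_space.distr_pair_fst[OF assms(1)])
  finally show ?thesis .
qed

end

section \<open>Time-averaged transfers of a control policy\<close>

locale controlled_network = bounded_independent_arrivals M A d Amax lam
  for M :: "'w measure" and A :: "'n::finite \<Rightarrow> 'c::finite \<Rightarrow> nat \<Rightarrow> 'w \<Rightarrow> nat"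
    and d :: "'c \<Rightarrow> 'n" and Amax :: nat and lam :: "'n \<Rightarrow> 'c \<Rightarrow> real" +
  fixes L :: "('n \<times> 'n) set" and cap :: "'n \<Rightarrow> 'n \<Rightarrow> real" and p :: "('n, 'c) policy"
  assumes policy: "control_policy L d cap M A p"
begin

abbreviation joint :: "('w \<times> real) measure" where
  "joint \<equiv> M \<Otimes>\<^sub>M seed p"

abbreviation transfer :: "nat \<Rightarrow> 'n \<Rightarrow> 'n \<Rightarrow> 'c \<Rightarrow> 'w \<times> real \<Rightarrow> real" where
  "transfer t a b c z \<equiv> sent p (history (arrival_path A (fst z)) t) (snd z) a b c"

lemma prob_space_seed: "prob_space (seed p)"
  using policy by (simp add: control_policy_def)

sublocale joint: prob_space joint
  using prob_space_axioms prob_space_seed by (rule prob_space_pair)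

lemma
  assumes z: "z \<in> space joint"
  shows transfer_nonneg: "(a, b) \<in> L \<Longrightarrow> 0 \<le> transfer t a b c z"
    and sum_transfer_le_cap: "(a, b) \<in> L \<Longrightarrow> (\<Sum>c\<in>UNIV. transfer t a b c z) \<le> cap a b"
    and discarded_nonneg: "0 \<le> discarded p (history (arrival_path A (fst z)) t) (snd z) n c"
    and removal_le_backlog: "(\<Sum>b | (n, b) \<in> L. transfer t n b c z)
      + discarded p (history (arrival_path A (fst z)) t) (snd z) n c
      \<le> backlog L d p (arrival_path A (fst z)) (snd z) t n c"
proof -
  have "fst z \<in> space M" "snd z \<in> space (seed p)"
    using z by (auto simp: space_pair_measure)
  then have *:
    "(\<forall>(a, b) \<in> L. (\<Sum>c\<in>UNIV. rate p (history (arrival_path A (fst z)) t) (snd z) a b c) \<le> cap a b) \<and>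
     (\<forall>(a, b) \<in> L. \<forall>c. 0 \<le> transfer t a b c z \<and>
        transfer t a b c z \<le> rate p (history (arrival_path A (fst z)) t) (snd z) a b c) \<and>
     (\<forall>n c. 0 \<le> discarded p (history (arrival_path A (fst z)) t) (snd z) n c) \<and>
     (\<forall>n c. (\<Sum>b | (n, b) \<in> L. transfer t n b c z)
        + discarded p (history (arrival_path A (fst z)) t) (snd z) n c
        \<le> backlog L d p (arrival_path A (fst z)) (snd z) t n c)"
    using policy unfolding control_policy_def Let_def by blast
  show "(a, b) \<in> L \<Longrightarrow> 0 \<le> transfer t a b c z"
    using * by blast
  show "(\<Sum>c\<in>UNIV. transfer t a b c z) \<le> cap a b" if link: "(a, b) \<in> L"
  proof -
    have "(\<Sum>c\<in>UNIV. transfer t a b c z)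
        \<le> (\<Sum>c\<in>UNIV. rate p (history (arrival_path A (fst z)) t) (snd z) a b c)"
      using * link by (intro sum_mono) blast
    also have "\<dots> \<le> cap a b" using * link by blast
    finally show ?thesis .
  qed
  show "0 \<le> discarded p (history (arrival_path A (fst z)) t) (snd z) n c"
    using * by blast
  show "(\<Sum>b | (n, b) \<in> L. transfer t n b c z)
      + discarded p (history (arrival_path A (fst z)) t) (snd z) n c
      \<le> backlog L d p (arrival_path A (fst z)) (snd z) t n c"
    using * by blast
qed

text \<open>
  The model has no separate constraint keeping queues nonnegative; it follows from the bound on what may
  be removed in the next slot.
\<close>

lemma backlog_nonneg:
  assumes "z \<in> space joint"
  shows "0 \<le> backlog L d p (arrival_path A (fst z)) (snd z) t n c"
proof -
  have "0 \<le> (\<Sum>b | (n, b) \<in> L. transfer t n b c z)"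
    using transfer_nonneg[OF assms] by (intro sum_nonneg) auto
  then show ?thesis
    using removal_le_backlog[OF assms, of t n c] discarded_nonneg[OF assms, of t n c] by linarith
qed

lemma transfer_from_destination:
  assumes z: "z \<in> space joint" and link: "(d c, b) \<in> L"
  shows "transfer t (d c) b c z = 0"
proof -
  have "backlog L d p (arrival_path A (fst z)) (snd z) t (d c) c = 0"
    by (cases t) simp_all
  then have "(\<Sum>b | (d c, b) \<in> L. transfer t (d c) b c z) \<le> 0"
    using removal_le_backlog[OF z, of t "d c" c] discarded_nonneg[OF z, of t "d c" c] by linarith
  moreover have "transfer t (d c) b c z \<le> (\<Sum>b | (d c, b) \<in> L. transfer t (d c) b c z)"
    using link transfer_nonneg[OF z] by (intro member_le_sum) auto
  ultimately show ?thesis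
    using transfer_nonneg[OF z link, of t c] by linarith
qed

lemma backlog_le_net_arrivals:
  assumes z: "z \<in> space joint" and n: "n \<noteq> d c"
  shows "backlog L d p (arrival_path A (fst z)) (snd z) (Suc t) n c \<le>
    (\<Sum>s\<le>t. real (A n c s (fst z)) + (\<Sum>a | (a, n) \<in> L. transfer s a n c z)
             - (\<Sum>b | (n, b) \<in> L. transfer s n b c z))"
proof (induction t)
  case 0
  then show ?case
    using n discarded_nonneg[OF z, of 0 n c] by (simp add: arrival_path_def[of A "fst z" 0 n c])
next
  case (Suc t)
  then show ?case
    using n discarded_nonneg[OF z, of "Suc t" n c]
    by (subst backlog.simps, subst sum.atMost_Suc) (simp add: arrival_path_def[of A "fst z" "Suc t" n c] del: backlog.simps)
qed

lemma total_transfer_out_le: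
  assumes z: "z \<in> space joint" and n: "n \<noteq> d c"
  shows "(\<Sum>b | (n, b) \<in> L. \<Sum>s\<le>t. transfer s n b c z) \<le>
    (\<Sum>s\<le>t. real (A n c s (fst z))) + (\<Sum>a | (a, n) \<in> L. \<Sum>s\<le>t. transfer s a n c z)"
  using order_trans[OF backlog_nonneg[OF z] backlog_le_net_arrivals[OF z n, of t]]
  by (simp add: sum.distrib sum_subtractf sum.swap[of _ _ "{..t}"])

text \<open>
  A policy is measurable in the seed for each fixed history only; joint measurability comes from the
  countability of the set of histories.
\<close>

lemma measurable_transfer [measurable]: "transfer t a b c \<in> borel_measurable joint"
proof -
  have "(\<lambda>z. sent p h (snd z) a b c) \<in> borel_measurable joint" for h
    using policy unfolding control_policy_def by (auto intro: measurable_compose[OF measurable_snd])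
  then show ?thesis
    by (rule measurable_compose_countable[where g = "\<lambda>z. history (arrival_path A (fst z)) t"])
      (rule measurable_compose[OF measurable_fst measurable_history])
qed

lemma transfer_le_cap:
  assumes z: "z \<in> space joint" and link: "(a, b) \<in> L"
  shows "transfer t a b c z \<le> cap a b"
proof -
  have "transfer t a b c z \<le> (\<Sum>c\<in>UNIV. transfer t a b c z)"
    using transfer_nonneg[OF z link] by (intro member_le_sum) auto
  then show ?thesis using sum_transfer_le_cap[OF z link, of t] by linarith
qed

lemma integrable_transfer:
  assumes "(a, b) \<in> L"
  shows "integrable joint (transfer t a b c)"
  using assms transfer_nonneg transfer_le_cap
  by (intro joint.integrable_const_bound[of _ "cap a b"]) (auto intro!: AE_I2)

lemma integral_arrival_joint: "(\<integral>z. real (A n c t (fst z)) \<partial>joint) = lam n c"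
  using integral_fst_pair[OF prob_space_seed, of "\<lambda>w. real (A n c t w)"] expectation_arrival by simp

lemma integrable_arrival_joint: "integrable joint (\<lambda>z. real (A n c t (fst z)))"
proof (rule joint.integrable_const_bound[of _ "real Amax"])
  show "AE z in joint. norm (real (A n c t (fst z))) \<le> real Amax"
    by (auto intro!: AE_I2 arrival_le simp: space_pair_measure)
qed measurable

text \<open>
  The interval \<open>[0, t]\<close> consists of \<open>t + 1\<close> slots. Dividing by \<open>t + 1\<close> instead of the \<open>t\<close> in the
  definition of throughput makes the capacity constraints hold exactly for every \<open>t\<close>.
\<close>

definition mean_flow :: "nat \<Rightarrow> 'n \<Rightarrow> 'n \<Rightarrow> 'c \<Rightarrow> real" where
  "mean_flow t a b c = (\<integral>z. cumulative_sent A p a b c t z \<partial>joint) / real (Suc t)"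

lemma cumulative_sent_eq: "cumulative_sent A p a b c t = (\<lambda>z. \<Sum>s\<le>t. transfer s a b c z)"
  by (simp add: cumulative_sent_def fun_eq_iff split_beta)

text \<open>
  Each constraint holds for the totals along every sample path: for the nodal inequality this is
  \<open>total_transfer_out_le\<close>. Taking expectations turns the total arrivals into \<open>(t + 1) * lam n c\<close>.
\<close>

lemma admissible_mean_flow: "admissible_flow L d cap lam (mean_flow t)"
proof -
  define m where "m a b c = (\<integral>z. cumulative_sent A p a b c t z \<partial>joint)" for a b c
  have mean: "mean_flow t a b c = m a b c / real (Suc t)" for a b c
    by (simp add: mean_flow_def m_def)
  have int: "integrable joint (\<lambda>z. \<Sum>s\<le>t. transfer s a b c z)" if "(a, b) \<in> L" for a b c
    using integrable_transfer[OF that] by (intro Bochner_Integration.integrable_sum) auto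
  have int_sum: "integrable joint (\<lambda>z. \<Sum>i | P i. \<Sum>s\<le>t. transfer s (g i) (h i) c z)"
    if "\<And>i. P i \<Longrightarrow> (g i, h i) \<in> L" for P and g h :: "'n \<Rightarrow> 'n" and c
    by (rule Bochner_Integration.integrable_sum) (use int that in auto)
  have "0 \<le> mean_flow t a b c" if "(a, b) \<in> L" for a b c
    unfolding mean_flow_def cumulative_sent_eq using transfer_nonneg that
    by (intro divide_nonneg_pos integral_nonneg_AE AE_I2 sum_nonneg) auto
  moreover have "mean_flow t (d c) b c = 0" if "(d c, b) \<in> L" for b c
  proof -
    have "m (d c) b c = (\<integral>z. 0 \<partial>joint)"
      unfolding m_def cumulative_sent_eq using transfer_from_destination that
      by (intro Bochner_Integration.integral_cong refl sum.neutral) auto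
    then show ?thesis by (simp add: mean)
  qed
  moreover have "(\<Sum>c\<in>UNIV. mean_flow t a b c) \<le> cap a b" if link: "(a, b) \<in> L" for a b
  proof -
    have "(\<Sum>c\<in>UNIV. m a b c) = (\<integral>z. (\<Sum>c\<in>UNIV. \<Sum>s\<le>t. transfer s a b c z) \<partial>joint)"
      unfolding m_def cumulative_sent_eq using int[OF link]
      by (intro Bochner_Integration.integral_sum[symmetric]) auto
    also have "\<dots> \<le> (\<integral>z. real (Suc t) * cap a b \<partial>joint)"
    proof (rule integral_mono)
      show "integrable joint (\<lambda>z. \<Sum>c\<in>UNIV. \<Sum>s\<le>t. transfer s a b c z)"
        by (rule Bochner_Integration.integrable_sum) (rule int[OF link])
      fix z assume z: "z \<in> space joint"
      have "(\<Sum>c\<in>UNIV. \<Sum>s\<le>t. transfer s a b c z) = (\<Sum>s\<le>t. \<Sum>c\<in>UNIV. transfer s a b c z)"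
        by (rule sum.swap)
      also have "\<dots> \<le> (\<Sum>s\<le>t. cap a b)"
        by (intro sum_mono sum_transfer_le_cap z link)
      finally show "(\<Sum>c\<in>UNIV. \<Sum>s\<le>t. transfer s a b c z) \<le> real (Suc t) * cap a b"
        by simp
    qed simp
    also have "\<dots> = real (Suc t) * cap a b"
      using joint.prob_space by simp
    finally show ?thesis
      by (simp add: mean divide_le_eq mult.commute flip: sum_divide_distrib)
  qed
  moreover have "outflow L (mean_flow t) n c \<le> lam n c + inflow L (mean_flow t) n c"
    if n: "n \<noteq> d c" for n c
  proof -
    have int_arrivals: "integrable joint (\<lambda>z. \<Sum>s\<le>t. real (A n c s (fst z)))"
      by (intro Bochner_Integration.integrable_sum integrable_arrival_joint)
    have arrivals: "(\<integral>z. (\<Sum>s\<le>t. real (A n c s (fst z))) \<partial>joint) = real (Suc t) * lam n c"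
      by (subst Bochner_Integration.integral_sum)
        (simp_all add: integrable_arrival_joint integral_arrival_joint)
    have out: "outflow L m n c = (\<integral>z. (\<Sum>b | (n, b) \<in> L. \<Sum>s\<le>t. transfer s n b c z) \<partial>joint)"
      unfolding m_def cumulative_sent_eq
      by (rule Bochner_Integration.integral_sum[symmetric]) (auto intro: int)
    have inn: "inflow L m n c = (\<integral>z. (\<Sum>a | (a, n) \<in> L. \<Sum>s\<le>t. transfer s a n c z) \<partial>joint)"
      unfolding m_def cumulative_sent_eq
      by (rule Bochner_Integration.integral_sum[symmetric]) (auto intro: int)
    have "outflow L m n c \<le> (\<integral>z. (\<Sum>s\<le>t. real (A n c s (fst z)))
        + (\<Sum>a | (a, n) \<in> L. \<Sum>s\<le>t. transfer s a n c z) \<partial>joint)"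
      unfolding out
      by (intro integral_mono Bochner_Integration.integrable_add int_arrivals int_sum
          total_transfer_out_le n) auto
    also have "\<dots> = real (Suc t) * lam n c + inflow L m n c"
      unfolding inn arrivals[symmetric]
      by (intro Bochner_Integration.integral_add int_arrivals int_sum) auto
    finally have "outflow L m n c / real (Suc t) \<le> (real (Suc t) * lam n c + inflow L m n c) / real (Suc t)"
      by (rule divide_right_mono) simp
    also have "\<dots> = lam n c + inflow L m n c / real (Suc t)"
      by (simp add: add_divide_distrib del: of_nat_Suc)
    finally show ?thesis
      by (simp only: mean sum_divide_distrib)
  qed
  ultimately show ?thesis
    by (auto simp: admissible_flow_def)
qed

text \<open>
  The lower limit exceeds \<open>r c - e / 2\<close> eventually, and the remaining \<open>e / 2\<close> pays for the change of the
  divisor from \<open>t\<close> to \<open>t + 1\<close>. As there are finitely many classes, one \<open>t\<close> serves all of them.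
\<close>

lemma throughput_approx_by_admissible_flow:
  assumes thr: "\<And>c. ereal (r c) \<le> throughput L d M A p c" and e: "0 < e"
  shows "\<exists>f. admissible_flow L d cap lam f \<and> (\<forall>c. r c - e \<le> inflow L f (d c) c)"
proof -
  have "eventually (\<lambda>t. r c - e \<le> inflow L (mean_flow t) (d c) c) sequentially" for c
  proof -
    define X where "X t = (\<Sum>a | (a, d c) \<in> L. \<integral>z. cumulative_sent A p a (d c) c t z \<partial>joint)" for t
    have inflow: "inflow L (mean_flow t) (d c) c = X t / real (Suc t)" for t
      by (simp add: mean_flow_def X_def sum_divide_distrib)
    have "ereal (r c - e / 2) < liminf (\<lambda>t. ereal (1 / real t * X t))"
      using thr[of c] e unfolding throughput_def X_def
      by (intro less_le_trans[OF _ thr[of c, unfolded throughput_def]]) simp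
    then have "eventually (\<lambda>t. r c - e / 2 < 1 / real t * X t) sequentially"
      by (drule_tac less_LiminfD) simp
    moreover have "(\<lambda>t. (r c - e / 2) * (real t / real (Suc t))) \<longlonglongrightarrow> (r c - e / 2) * 1"
      by (intro tendsto_mult tendsto_const LIMSEQ_n_over_Suc_n)
    then have "eventually (\<lambda>t. r c - e < (r c - e / 2) * (real t / real (Suc t))) sequentially"
      by (rule order_tendstoD) (use e in simp)
    ultimately show ?thesis
      using eventually_gt_at_top[of 0]
    proof eventually_elim
      case (elim t)
      then have "(r c - e / 2) * real t \<le> X t"
        by (simp add: field_simps)
      then have "(r c - e / 2) * real t / real (Suc t) \<le> X t / real (Suc t)"
        by (rule divide_right_mono) simp
      then show ?case using elim(2) by (simp add: inflow)
    qed
  qed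
  then have "eventually (\<lambda>t. \<forall>c. r c - e \<le> inflow L (mean_flow t) (d c) c) sequentially"
    by (rule eventually_all_finite)
  then obtain t where "\<forall>c. r c - e \<le> inflow L (mean_flow t) (d c) c"
    by (auto simp: eventually_sequentially)
  then show ?thesis using admissible_mean_flow by blast
qed

end

section \<open>Serving every link at its flow rate\<close>

text \<open>
  Since amounts are real numbers, a node that is short of class \<open>c\<close> packets can shrink all its outgoing
  transfers by the same factor. Common shrinking is what lets one number per node, rather than one per
  link, measure how far the policy falls behind the flow. At a node without outflow the value is
  \<open>0\<close> by the convention for division, and is only ever multiplied by \<open>0\<close>.
\<close>

definition service_fraction ::
  "('n::finite \<times> 'n) set \<Rightarrow> ('n \<Rightarrow> 'n \<Rightarrow> 'c \<Rightarrow> real) \<Rightarrow> ('n \<Rightarrow> 'c \<Rightarrow> real) \<Rightarrow> 'n \<Rightarrow> 'c \<Rightarrow> real" where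
  "service_fraction L f U n c = min 1 (U n c / outflow L f n c)"

text \<open>
  This is the recursion that \<open>backlog\<close> will satisfy for the fluid policy. It has to be stated
  before the policy because the decisions of the policy depend on it.
\<close>

primrec fluid_backlog ::
  "('n::finite \<times> 'n) set \<Rightarrow> ('c \<Rightarrow> 'n) \<Rightarrow> ('n \<Rightarrow> 'n \<Rightarrow> 'c \<Rightarrow> real) \<Rightarrow> (nat \<Rightarrow> 'n \<Rightarrow> 'c \<Rightarrow> nat) \<Rightarrow>
    nat \<Rightarrow> 'n \<Rightarrow> 'c \<Rightarrow> real" where
  "fluid_backlog L d f x 0 = (\<lambda>n c. 0)"
| "fluid_backlog L d f x (Suc t) = (\<lambda>n c.
     if n = d c then 0
     else fluid_backlog L d f x t n c
        - (\<Sum>b | (n, b) \<in> L. f n b c * service_fraction L f (fluid_backlog L d f x t) n c)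
        + real (x t n c)
        + (\<Sum>a | (a, n) \<in> L. f a n c * service_fraction L f (fluid_backlog L d f x t) a c))"

text \<open>
  A history of the slots \<open>0, \<dots>, t\<close> has length \<open>t + 1\<close>, and the backlog at the beginning of slot \<open>t\<close>
  involves the entries before \<open>t\<close> only. The policy is deterministic, hence the one-point seed.
\<close>

definition fluid_policy ::
  "('n::finite \<times> 'n) set \<Rightarrow> ('c \<Rightarrow> 'n) \<Rightarrow> ('n \<Rightarrow> 'n \<Rightarrow> 'c \<Rightarrow> real) \<Rightarrow> ('n, 'c) policy" where
  "fluid_policy L d f =
     \<lparr>seed = return borel 0,
      rate = \<lambda>h u. f,
      sent = \<lambda>h u a b c.
        f a b c * service_fraction L f (fluid_backlog L d f ((!) h) (length h - 1)) a c,
      discarded = \<lambda>h u n c. 0\<rparr>"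

lemma fluid_backlog_cong:
  "(\<And>s. s < t \<Longrightarrow> x s = y s) \<Longrightarrow> fluid_backlog L d f x t = fluid_backlog L d f y t"
  by (induction t) (simp_all cong: if_cong)

lemma sent_fluid_policy:
  "sent (fluid_policy L d f) (history x t) u a b c =
    f a b c * service_fraction L f (fluid_backlog L d f x t) a c"
proof -
  have "fluid_backlog L d f ((!) (history x t)) t = fluid_backlog L d f x t"
    by (rule fluid_backlog_cong) (simp add: history_def nth_append del: upt_Suc)
  then show ?thesis by (simp add: fluid_policy_def history_def del: upt_Suc)
qed

lemma backlog_fluid_policy: "backlog L d (fluid_policy L d f) x u t = fluid_backlog L d f x t"
proof (induction t)
  case (Suc t)
  have "discarded (fluid_policy L d f) h u n c = 0" for h n c
    by (simp add: fluid_policy_def)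
  then show ?case by (simp add: Suc sent_fluid_policy cong: if_cong)
qed simp

locale fluid_network =
  fixes L :: "('n::finite \<times> 'n) set" and d :: "'c::finite \<Rightarrow> 'n" and cap :: "'n \<Rightarrow> 'n \<Rightarrow> real"
    and lam :: "'n \<Rightarrow> 'c \<Rightarrow> real" and f :: "'n \<Rightarrow> 'n \<Rightarrow> 'c \<Rightarrow> real"
  assumes admissible: "admissible_flow L d cap lam f"
begin

lemmas flowD = admissible_flowD[OF admissible]

lemma outflow_nonneg: "0 \<le> outflow L f n c"
  using flowD(1) by (intro sum_nonneg) auto

lemma inflow_nonneg: "0 \<le> inflow L f n c"
  using flowD(1) by (intro sum_nonneg) auto

context
  fixes x :: "nat \<Rightarrow> 'n \<Rightarrow> 'c \<Rightarrow> nat"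
begin

abbreviation stock :: "nat \<Rightarrow> 'n \<Rightarrow> 'c \<Rightarrow> real" where
  "stock t \<equiv> fluid_backlog L d f x t"

definition deficit :: "nat \<Rightarrow> 'n \<Rightarrow> 'c \<Rightarrow> real" where
  "deficit t n c = 1 - service_fraction L f (stock t) n c"

text \<open>
  This is the reason for the choice of the fraction: a node works at full rate or empties its queue.
\<close>

lemma total_service:
  assumes "0 \<le> U n c"
  shows "(\<Sum>b | (n, b) \<in> L. f n b c * service_fraction L f U n c) = min (outflow L f n c) (U n c)"
  using assms outflow_nonneg[of n c]
  by (auto simp: service_fraction_def min_def divide_le_eq le_divide_eq simp flip: sum_distrib_right)

lemma service_fraction_nonneg: "0 \<le> U n c \<Longrightarrow> 0 \<le> service_fraction L f U n c"
  using outflow_nonneg by (simp add: service_fraction_def)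

lemma stock_nonneg: "0 \<le> stock t n c"
proof (induction t arbitrary: n)
  case (Suc t)
  have "0 \<le> (\<Sum>a | (a, n) \<in> L. f a n c * service_fraction L f (stock t) a c)"
    using Suc flowD(1) by (intro sum_nonneg mult_nonneg_nonneg service_fraction_nonneg) auto
  then show ?case
    using total_service[of "stock t" n c] Suc by simp
qed simp

lemma deficit_bounds: "0 \<le> deficit t n c" "deficit t n c \<le> 1"
  using service_fraction_nonneg[OF stock_nonneg] by (auto simp: deficit_def service_fraction_def)

lemma service_fraction_stock: "service_fraction L f (stock t) n c = 1 - deficit t n c"
  by (simp add: deficit_def)

text \<open>
  A reflected random walk: the backlog is what it would be if the flow were served everywhere,
  corrected for what upstream nodes failed to send and for what the node itself could not send.
\<close>

lemma stock_Suc_eq: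
  assumes n: "n \<noteq> d c"
  shows "stock (Suc t) n c =
    (\<Sum>s\<le>t. real (x s n c)) + real (Suc t) * (inflow L f n c - outflow L f n c)
    - (\<Sum>a | (a, n) \<in> L. f a n c * (\<Sum>s\<le>t. deficit s a c)) + outflow L f n c * (\<Sum>s\<le>t. deficit s n c)"
proof (induction t)
  case 0
  have "stock 0 n c = 0" by simp
  then show ?case
    using n by (subst fluid_backlog.simps)
      (simp add: service_fraction_stock right_diff_distrib sum_subtractf sum_distrib_right
        del: fluid_backlog.simps)
next
  case (Suc t)
  have "stock (Suc (Suc t)) n c = stock (Suc t) n c
      - outflow L f n c * (1 - deficit (Suc t) n c) + real (x (Suc t) n c)
      + (inflow L f n c - (\<Sum>a | (a, n) \<in> L. f a n c * deficit (Suc t) a c))"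
    using n by (subst fluid_backlog.simps)
      (simp add: service_fraction_stock right_diff_distrib sum_subtractf sum_distrib_right
        del: fluid_backlog.simps)
  then show ?case
    unfolding Suc by (simp add: algebra_simps sum.distrib)
qed

text \<open>
  A node with a deficit sends its whole backlog, so only the new arrivals of the slot remain.
\<close>

lemma stock_Suc_le_of_deficit:
  assumes n: "n \<noteq> d c" and out: "outflow L f n c \<noteq> 0" and pos: "0 < deficit t n c"
  shows "stock (Suc t) n c \<le> real (x t n c) + inflow L f n c"
proof -
  have "stock t n c \<le> outflow L f n c"
    using pos out outflow_nonneg[of n c]
    by (auto simp: deficit_def service_fraction_def min_def divide_le_eq split: if_splits)
  then have "(\<Sum>b | (n, b) \<in> L. f n b c * service_fraction L f (stock t) n c) = stock t n c"
    using total_service[OF stock_nonneg] by simp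
  moreover have "(\<Sum>a | (a, n) \<in> L. f a n c * service_fraction L f (stock t) a c) \<le> inflow L f n c"
    using flowD(1) by (intro sum_mono mult_left_le) (auto simp: service_fraction_def)
  ultimately show ?thesis using n by simp
qed

text \<open>
  The left-hand side grows only in slots in which the node has a deficit. In such a slot the backlog
  is bounded by \<open>stock_Suc_le_of_deficit\<close>, and \<open>stock_Suc_eq\<close> expresses the left-hand side by this
  backlog, the upstream deficits and the accumulated drift, which
  \<open>outflow \<le> lam + inflow\<close> bounds by the shortfall of the arrivals. The right-hand side never decreases, so the
  bound persists until the next deficit. The shortfall has to be controlled at all times \<open>\<tau> \<le> t\<close> because the
  last deficit may occur at any of them.
\<close>

lemma outflow_deficit_le:
  assumes n: "n \<noteq> d c" and x: "\<And>s. x s n c \<le> Amax" and e: "0 \<le> e"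
    and dev: "\<And>\<tau>. \<tau> \<le> t \<Longrightarrow> (\<Sum>s\<le>\<tau>. lam n c - real (x s n c)) \<le> e"
  shows "outflow L f n c * (\<Sum>s\<le>t. deficit s n c) \<le>
    real Amax + inflow L f n c + e + (\<Sum>a | (a, n) \<in> L. f a n c * (\<Sum>s\<le>t. deficit s a c))"
proof -
  have rhs_nonneg: "0 \<le> real Amax + inflow L f n c + e
      + (\<Sum>a | (a, n) \<in> L. f a n c * (\<Sum>s\<le>t. deficit s a c))" for t
    using e inflow_nonneg flowD(1) deficit_bounds(1)
    by (intro add_nonneg_nonneg sum_nonneg mult_nonneg_nonneg) auto
  have in_deficit: "outflow L f n c * (\<Sum>s\<le>t. deficit s n c) \<le> real Amax + inflow L f n c + e
      + (\<Sum>a | (a, n) \<in> L. f a n c * (\<Sum>s\<le>t. deficit s a c))"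
    if pos: "deficit t n c \<noteq> 0" and dev: "(\<Sum>s\<le>t. lam n c - real (x s n c)) \<le> e" for t
  proof (cases "outflow L f n c = 0")
    case True
    then show ?thesis using rhs_nonneg by simp
  next
    case False
    have "stock (Suc t) n c \<le> real Amax + inflow L f n c"
      using stock_Suc_le_of_deficit[OF n False, of t] pos deficit_bounds(1)[of t n c] x[of t] by simp
    moreover have "real (Suc t) * (outflow L f n c - inflow L f n c) \<le> real (Suc t) * lam n c"
      using flowD(4)[OF n] by (intro mult_left_mono) auto
    moreover have "real (Suc t) * lam n c - (\<Sum>s\<le>t. real (x s n c)) \<le> e"
      using dev by (simp add: sum_subtractf)
    ultimately show ?thesis
      unfolding stock_Suc_eq[OF n] by (simp add: algebra_simps)
  qed
  show ?thesis using dev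
  proof (induction t)
    case 0
    then show ?case
      using in_deficit[of 0] rhs_nonneg[of 0] by (cases "deficit 0 n c = 0") simp_all
  next
    case (Suc t)
    show ?case
    proof (cases "deficit (Suc t) n c = 0")
      case True
      have "outflow L f n c * (\<Sum>s\<le>t. deficit s n c) \<le> real Amax + inflow L f n c + e
          + (\<Sum>a | (a, n) \<in> L. f a n c * (\<Sum>s\<le>t. deficit s a c))"
        by (rule Suc.IH) (use Suc.prems in simp)
      also have "\<dots> \<le> real Amax + inflow L f n c + e
          + (\<Sum>a | (a, n) \<in> L. f a n c * (\<Sum>s\<le>Suc t. deficit s a c))"
        using flowD(1) deficit_bounds(1) by (intro add_left_mono sum_mono mult_left_mono) auto
      finally show ?thesis using True by simp
    next
      case False
      then show ?thesis using in_deficit[of "Suc t"] Suc.prems[of "Suc t"] by blast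
    qed
  qed
qed

text \<open>
  Weight the flow on each link with the total deficit of its tail. By \<open>outflow_deficit_le\<close> the
  weighted flow has a bounded net supply at every node other than \<open>d c\<close>, hence a bounded inflow at
  \<open>d c\<close>, and this inflow is precisely what the destination misses compared with full service. Cycles in \<open>f\<close>
  do no harm, since their deficits cancel in the sum.
\<close>

lemma delivery_lower_bound:
  assumes x: "\<And>s n. x s n c \<le> Amax" and e: "0 \<le> e"
    and dev: "\<And>n \<tau>. n \<noteq> d c \<Longrightarrow> \<tau> \<le> t \<Longrightarrow> (\<Sum>s\<le>\<tau>. lam n c - real (x s n c)) \<le> e"
  shows "real (Suc t) * inflow L f (d c) c - (\<Sum>n | n \<noteq> d c. real Amax + inflow L f n c + e) \<le>
    (\<Sum>a | (a, d c) \<in> L. \<Sum>s\<le>t. f a (d c) c * service_fraction L f (stock s) a c)"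
proof -
  define D where "D n = (\<Sum>s\<le>t. deficit s n c)" for n
  have "(\<Sum>b | (d c, b) \<in> L. f (d c) b c * D (d c)) = 0"
    using flowD(2) by (intro sum.neutral) auto
  then have "(\<Sum>a | (a, d c) \<in> L. f a (d c) c * D a) =
      (\<Sum>n | n \<noteq> d c. (\<Sum>b | (n, b) \<in> L. f n b c * D n) - (\<Sum>a | (a, n) \<in> L. f a n c * D a))"
    using inflow_minus_outflow_eq_net_supply[where L = L and z = "d c" and g = "\<lambda>a b. f a b c * D a"]
    by simp
  also have "\<dots> \<le> (\<Sum>n | n \<noteq> d c. real Amax + inflow L f n c + e)"
  proof (rule sum_mono)
    fix n assume "n \<in> {n. n \<noteq> d c}"
    then have n: "n \<noteq> d c" by simp
    show "(\<Sum>b | (n, b) \<in> L. f n b c * D n) - (\<Sum>a | (a, n) \<in> L. f a n c * D a)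
        \<le> real Amax + inflow L f n c + e"
      using outflow_deficit_le[where t = t, OF n x e dev[OF n]] by (simp add: D_def flip: sum_distrib_right)
  qed
  finally have "(\<Sum>a | (a, d c) \<in> L. f a (d c) c * D a) \<le> (\<Sum>n | n \<noteq> d c. real Amax + inflow L f n c + e)" .
  moreover have "(\<Sum>a | (a, d c) \<in> L. \<Sum>s\<le>t. f a (d c) c * service_fraction L f (stock s) a c) =
      (\<Sum>a | (a, d c) \<in> L. real (Suc t) * f a (d c) c - f a (d c) c * D a)"
    by (intro sum.cong refl)
      (simp add: service_fraction_stock right_diff_distrib sum_subtractf D_def sum_distrib_left)
  ultimately show ?thesis
    by (simp add: sum_subtractf sum_distrib_left)
qed

end

lemma control_policy_fluid_policy: "control_policy L d cap M A (fluid_policy L d f)"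
proof -
  have [simp]: "rate (fluid_policy L d f) h u = f" "seed (fluid_policy L d f) = return borel 0"
    "discarded (fluid_policy L d f) h u n c = 0" for h u n c
    by (simp_all add: fluid_policy_def)
  have "(\<lambda>u. sent (fluid_policy L d f) h u a b c) \<in> borel_measurable (return borel 0)" for h a b c
    by (simp add: fluid_policy_def)
  moreover have "prob_space (return borel (0::real))"
    by (rule prob_space_return) simp
  moreover have "f a b c * service_fraction L f (fluid_backlog L d f x t) a c \<in> {0..f a b c}"
    if "(a, b) \<in> L" for x t a b c
  proof -
    have "service_fraction L f (fluid_backlog L d f x t) a c \<le> 1"
      by (simp add: service_fraction_def)
    then show ?thesis
      using flowD(1)[OF that] service_fraction_nonneg[OF stock_nonneg]
      by (simp add: mult_left_le)
  qed
  moreover have "(\<Sum>b | (n, b) \<in> L. f n b c * service_fraction L f (fluid_backlog L d f x t) n c)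
      \<le> fluid_backlog L d f x t n c" for x t n c
    using total_service[OF stock_nonneg] by simp
  ultimately show ?thesis
    using flowD(1,3) unfolding control_policy_def Let_def
    by (auto simp: sent_fluid_policy backlog_fluid_policy split: prod.splits)
qed

end

section \<open>Throughput of the fluid policy\<close>

context bounded_independent_arrivals
begin

text \<open>
  Hoeffding's inequality for the arrivals of one node and class. They are placed in
  the interval from \<open>0\<close> to \<open>Amax + 1\<close>, whose length is positive even if \<open>Amax = 0\<close>.
\<close>

lemma prob_shortfall_le:
  assumes n: "n \<noteq> d c" and y: "0 \<le> y"
  shows "prob {w \<in> space M. y \<le> (\<Sum>s\<le>t. lam n c - real (A n c s w))} \<le>
    exp (- 2 * y\<^sup>2 / (real (Suc t) * (real Amax + 1)\<^sup>2))"
proof -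
  define I where "I = (\<lambda>s. (n, c, s)) ` {..t}"
  define X where "X = (\<lambda>(n, c, s) w. real (A n c s w))"
  have inj: "inj_on (\<lambda>s. (n, c, s)) {..t}"
    by (rule inj_onI) simp
  have "indep_vars (\<lambda>_. borel) (\<lambda>i w. real ((\<lambda>(n, c, t). A n c t) i w)) {(n, c, t). n \<noteq> d c}"
    by (rule indep_vars_compose2[OF indep_arrivals]) simp
  also have "(\<lambda>i w. real ((\<lambda>(n, c, t). A n c t) i w)) = X"
    by (auto simp: X_def fun_eq_iff)
  finally have "indep_vars (\<lambda>_. borel) X I"
    by (rule indep_vars_subset) (use n in \<open>auto simp: I_def\<close>)
  then interpret Hoeffding_ineq M I X "\<lambda>_. 0" "\<lambda>_. real Amax + 1" "\<Sum>i\<in>I. expectation (X i)"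
  proof unfold_locales
    have "real (A n c s w) \<le> real Amax + 1" if "w \<in> space M" for n c s w
      using arrival_le[OF that, of n c s] by linarith
    then show "AE w in M. X i w \<in> {0..real Amax + 1}" for i
      by (intro AE_I2) (auto simp: X_def split: prod.splits)
  qed (auto simp: I_def)
  have mean: "(\<Sum>i\<in>I. expectation (X i)) = (\<Sum>s\<le>t. lam n c)"
    unfolding I_def by (subst sum.reindex[OF inj]) (simp add: X_def expectation_arrival)
  have total: "(\<Sum>i\<in>I. X i w) = (\<Sum>s\<le>t. real (A n c s w))" for w
    unfolding I_def by (subst sum.reindex[OF inj]) (simp add: X_def)
  have card: "card I = Suc t"
    unfolding I_def by (subst card_image[OF inj]) simp
  have "{w \<in> space M. y \<le> (\<Sum>s\<le>t. lam n c - real (A n c s w))} =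
      {w \<in> space M. (\<Sum>i\<in>I. X i w) \<le> (\<Sum>i\<in>I. expectation (X i)) - y}"
    unfolding mean total by (auto simp: sum_subtractf)
  also have "prob \<dots> \<le> exp (- 2 * y\<^sup>2 / (\<Sum>i\<in>I. (real Amax + 1 - 0)\<^sup>2))"
    by (rule Hoeffding_ineq_le[OF y]) (simp add: card)
  finally show ?thesis by (simp add: card)
qed

definition shortfall_event :: "'c \<Rightarrow> nat \<Rightarrow> real \<Rightarrow> 'w set" where
  "shortfall_event c t y = (\<Union>n\<in>{n. n \<noteq> d c}. \<Union>\<tau>\<in>{..t}.
     {w \<in> space M. y \<le> (\<Sum>s\<le>\<tau>. lam n c - real (A n c s w))})"

lemma sets_shortfall_event: "shortfall_event c t y \<in> sets M"
  unfolding shortfall_event_def by measurable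

lemma prob_shortfall_event_le:
  assumes y: "0 \<le> y"
  shows "prob (shortfall_event c t y) \<le>
    real (card {n. n \<noteq> d c}) * real (Suc t) * exp (- 2 * y\<^sup>2 / (real (Suc t) * (real Amax + 1)\<^sup>2))"
    (is "_ \<le> _ * _ * ?bound")
proof -
  let ?E = "\<lambda>n \<tau>. {w \<in> space M. y \<le> (\<Sum>s\<le>\<tau>. lam n c - real (A n c s w))}"
  have E: "?E n \<tau> \<in> sets M" for n \<tau> by measurable
  have single: "prob (?E n \<tau>) \<le> ?bound" if "n \<noteq> d c" "\<tau> \<le> t" for n \<tau>
  proof -
    have "2 * y\<^sup>2 / (real (Suc t) * (real Amax + 1)\<^sup>2) \<le> 2 * y\<^sup>2 / (real (Suc \<tau>) * (real Amax + 1)\<^sup>2)"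
      using that(2) by (intro divide_left_mono mult_right_mono mult_pos_pos) auto
    then show ?thesis
      using prob_shortfall_le[OF that(1) y, of \<tau>] by (simp add: order_trans)
  qed
  have "prob (shortfall_event c t y) \<le> (\<Sum>n | n \<noteq> d c. prob (\<Union>\<tau>\<in>{..t}. ?E n \<tau>))"
    unfolding shortfall_event_def using E by (intro finite_measure_subadditive_finite) auto
  also have "\<dots> \<le> (\<Sum>n | n \<noteq> d c. \<Sum>\<tau>\<le>t. prob (?E n \<tau>))"
    using E by (intro sum_mono finite_measure_subadditive_finite) auto
  also have "\<dots> \<le> (\<Sum>n | n \<noteq> d c. \<Sum>\<tau>\<le>t. ?bound)"
    using single by (intro sum_mono) auto
  finally show ?thesis by simp
qed

text \<open>
  No transfer exceeds its flow rate, which bounds the throughput from above. For the lower bound the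
  shortfall threshold \<open>y\<close> at time \<open>t\<close> must be \<open>o(t)\<close>, so that the loss is negligible, but of larger order than
  \<open>sqrt t\<close>, so that Hoeffding's bound beats the factor \<open>t + 1\<close> of the union bound. The exponent \<open>3/4\<close>
  satisfies both. On the exceptional event the deliveries are bounded below by \<open>0\<close>.
\<close>

lemma throughput_fluid_policy:
  assumes "admissible_flow L d cap lam f"
  shows "throughput L d M A (fluid_policy L d f) c = ereal (inflow L f (d c) c)"
proof -
  interpret fluid_network L d cap lam f by unfold_locales (rule assms)
  interpret controlled_network M A d Amax lam L cap "fluid_policy L d f"
    by unfold_locales (rule control_policy_fluid_policy)
  define N where "N = card {n. n \<noteq> d c}"
  define V where "V = inflow L f (d c) c"
  define B where "B = (\<Sum>n | n \<noteq> d c. real Amax + inflow L f n c)"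
  define K where "K = real Amax + 1"
  have K: "K > 0" by (simp add: K_def)
  define X where "X t = (\<Sum>a | (a, d c) \<in> L.
    \<integral>z. cumulative_sent A (fluid_policy L d f) a (d c) c t z \<partial>joint)" for t
  define y where "y t = real (Suc t) powr (3/4)" for t
  define \<epsilon> where "\<epsilon> t = real N * real (Suc t) * exp (- 2 * (y t)\<^sup>2 / (real (Suc t) * K\<^sup>2))" for t
  have y: "0 \<le> y t" for t by (simp add: y_def)
  have V: "0 \<le> V" unfolding V_def by (rule inflow_nonneg)
  have delivered_le: "transfer s a b c z \<le> f a b c" if "(a, b) \<in> L" for s a b z
    using flowD(1)[OF that] by (auto simp: sent_fluid_policy service_fraction_def intro: mult_left_le)
  have int: "integrable joint (\<lambda>z. \<Sum>a | (a, d c) \<in> L. \<Sum>s\<le>t. transfer s a (d c) c z)" for t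
    by (intro Bochner_Integration.integrable_sum integrable_transfer) auto
  have X_eq: "X t = (\<integral>z. (\<Sum>a | (a, d c) \<in> L. \<Sum>s\<le>t. transfer s a (d c) c z) \<partial>joint)" for t
    unfolding X_def cumulative_sent_eq
    by (intro Bochner_Integration.integral_sum[symmetric] Bochner_Integration.integrable_sum
        integrable_transfer) auto
  have upper: "X t \<le> real (Suc t) * V" for t
  proof -
    have "X t \<le> (\<integral>z. real (Suc t) * V \<partial>joint)"
      unfolding X_eq
    proof (rule integral_mono[OF int])
      fix z
      have "(\<Sum>a | (a, d c) \<in> L. \<Sum>s\<le>t. transfer s a (d c) c z)
          \<le> (\<Sum>a | (a, d c) \<in> L. \<Sum>s\<le>t. f a (d c) c)"
        by (intro sum_mono delivered_le) auto
      then show "(\<Sum>a | (a, d c) \<in> L. \<Sum>s\<le>t. transfer s a (d c) c z) \<le> real (Suc t) * V"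
        by (simp add: V_def sum_distrib_left)
    qed simp
    then show ?thesis using joint.prob_space by simp
  qed
  have lower: "real (Suc t) * V - B - real N * y t - real (Suc t) * V * \<epsilon> t \<le> X t" for t
  proof -
    define S where "S = shortfall_event c t (y t)"
    have S [measurable]: "S \<in> sets M" unfolding S_def by (rule sets_shortfall_event)
    let ?low = "\<lambda>w. real (Suc t) * V - B - real N * y t - real (Suc t) * V * indicator S w"
    have int_low: "integrable M ?low"
      using S by (intro Bochner_Integration.integrable_diff integrable_mult_right integrable_const)
        (auto simp: integrable_indicator_iff less_top[symmetric])
    have "(\<integral>w. ?low w \<partial>M) = real (Suc t) * V - B - real N * y t - real (Suc t) * V * prob S"
      using S by (simp add: prob_space Bochner_Integration.integral_diff less_top[symmetric])
    moreover have "(\<integral>w. ?low w \<partial>M) = (\<integral>z. ?low (fst z) \<partial>joint)"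
      using S by (intro integral_fst_pair[OF prob_space_seed, symmetric]) measurable
    moreover have "(\<integral>z. ?low (fst z) \<partial>joint) \<le> X t"
      unfolding X_eq
    proof (rule integral_mono[OF _ int])
      have "integrable (distr joint M fst) ?low"
        using prob_space.distr_pair_fst[OF prob_space_seed, of M] int_low by simp
      then show "integrable joint (\<lambda>z. ?low (fst z))"
        by (subst (asm) integrable_distr_eq) (use S in measurable)
    next
      fix z assume z: "z \<in> space joint"
      then have w: "fst z \<in> space M" by (auto simp: space_pair_measure)
      show "?low (fst z) \<le> (\<Sum>a | (a, d c) \<in> L. \<Sum>s\<le>t. transfer s a (d c) c z)"
      proof (cases "fst z \<in> S")
        case True
        have "0 \<le> (\<Sum>a | (a, d c) \<in> L. \<Sum>s\<le>t. transfer s a (d c) c z)"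
          using transfer_nonneg[OF z] by (intro sum_nonneg) auto
        moreover have "0 \<le> B"
          unfolding B_def using inflow_nonneg by (intro sum_nonneg) simp
        moreover have "0 \<le> real N * y t" using y by simp
        ultimately show ?thesis using True by simp
      next
        case False
        have "(\<Sum>s\<le>\<tau>. lam n c - real (arrival_path A (fst z) s n c)) \<le> y t"
          if "n \<noteq> d c" "\<tau> \<le> t" for n \<tau>
          using False that w by (force simp: S_def shortfall_event_def arrival_path_def)
        moreover have "arrival_path A (fst z) s n c \<le> Amax" for s n
          using arrival_le[OF w] by (simp add: arrival_path_def)
        ultimately have "real (Suc t) * V - (\<Sum>n | n \<noteq> d c. real Amax + inflow L f n c + y t)
            \<le> (\<Sum>a | (a, d c) \<in> L. \<Sum>s\<le>t. transfer s a (d c) c z)"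
          unfolding V_def sent_fluid_policy by (intro delivery_lower_bound y)
        moreover have "(\<Sum>n | n \<noteq> d c. real Amax + inflow L f n c + y t) = B + real N * y t"
          by (simp add: B_def N_def sum.distrib)
        ultimately show ?thesis using False by simp
      qed
    qed
    moreover have "real (Suc t) * V * prob S \<le> real (Suc t) * V * \<epsilon> t"
      using prob_shortfall_event_le[OF y, of c t t] V
      by (intro mult_left_mono) (auto simp: S_def \<epsilon>_def N_def K_def)
    ultimately show ?thesis by linarith
  qed
  have lim1: "(\<lambda>t. real (Suc t) / real t) \<longlonglongrightarrow> 1"
    by real_asymp
  have lim2: "(\<lambda>t. y t / real t) \<longlonglongrightarrow> 0"
    unfolding y_def by real_asymp
  have lim3: "(\<lambda>t. \<epsilon> t) \<longlonglongrightarrow> 0"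
  proof -
    have "(\<lambda>t. real (Suc t) * exp (- 2 * (real (Suc t) powr (3/4))\<^sup>2 / (real (Suc t) * K\<^sup>2))) \<longlonglongrightarrow> 0"
      using K by real_asymp
    from tendsto_mult[OF tendsto_const[of "real N"] this] show ?thesis
      by (simp add: \<epsilon>_def y_def mult.assoc)
  qed
  have "(\<lambda>t. 1 / real t * X t) \<longlonglongrightarrow> V"
  proof (rule tendsto_sandwich)
    show "eventually (\<lambda>t. real (Suc t) / real t * V - B * (1 / real t) - real N * (y t / real t)
        - real (Suc t) / real t * V * \<epsilon> t \<le> 1 / real t * X t) sequentially"
      using eventually_gt_at_top[of 0]
    proof eventually_elim
      case (elim t)
      have "(real (Suc t) * V - B - real N * y t - real (Suc t) * V * \<epsilon> t) / real t \<le> X t / real t"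
        by (rule divide_right_mono[OF lower]) simp
      then show ?case by (simp add: diff_divide_distrib)
    qed
    show "eventually (\<lambda>t. 1 / real t * X t \<le> real (Suc t) / real t * V) sequentially"
      using upper by (intro always_eventually allI) (auto simp: divide_right_mono)
    have "(\<lambda>t. real (Suc t) / real t * V - B * (1 / real t) - real N * (y t / real t)
        - real (Suc t) / real t * V * \<epsilon> t) \<longlonglongrightarrow> 1 * V - B * 0 - real N * 0 - 1 * V * 0"
      by (intro tendsto_diff tendsto_mult tendsto_const lim1 lim2 lim3 lim_1_over_n)
    then show "(\<lambda>t. real (Suc t) / real t * V - B * (1 / real t) - real N * (y t / real t)
        - real (Suc t) / real t * V * \<epsilon> t) \<longlonglongrightarrow> V" by simp
    show "(\<lambda>t. real (Suc t) / real t * V) \<longlonglongrightarrow> V"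
      using tendsto_mult[OF lim1 tendsto_const[of V]] by simp
  qed
  then show ?thesis
    unfolding throughput_def X_def[symmetric] V_def[symmetric]
    by (intro lim_imp_Liminf tendsto_ereal) simp_all
qed

lemma throughput_region_iff_admissible_flow:
  fixes r :: "real ^ 'c"
  assumes r: "\<And>c. 0 \<le> r $ c"
  shows "r \<in> throughput_region L d cap M A \<longleftrightarrow>
    (\<exists>f. admissible_flow L d cap lam f \<and> (\<forall>c. r $ c \<le> inflow L f (d c) c))"
proof
  assume region: "r \<in> throughput_region L d cap M A"
  show "\<exists>f. admissible_flow L d cap lam f \<and> (\<forall>c. r $ c \<le> inflow L f (d c) c)"
  proof (rule admissible_flow_limit)
    fix e :: real assume e: "0 < e"
    then obtain r' where "r' \<in> achievable L d cap M A" and dist: "dist r' r < e / 2"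
      using region by (metis throughput_region_def closure_approachable half_gt_zero)
    then obtain p where p: "control_policy L d cap M A p"
      and thr: "\<And>c. ereal (r' $ c) = throughput L d M A p c"
      unfolding achievable_def by blast
    interpret controlled_network M A d Amax lam L cap p by unfold_locales (rule p)
    obtain f where f: "admissible_flow L d cap lam f" "\<And>c. r' $ c - e / 2 \<le> inflow L f (d c) c"
      using throughput_approx_by_admissible_flow[of "\<lambda>c. r' $ c" "e / 2"] thr e by auto
    have "r $ c - e \<le> inflow L f (d c) c" for c
      using f(2)[of c] dist_vec_nth_le[of r' c r] dist by (simp add: dist_real_def)
    then show "\<exists>f. admissible_flow L d cap lam f \<and> (\<forall>c. r $ c - e \<le> inflow L f (d c) c)"
      using f(1) by blast
  qed
next
  assume "\<exists>f. admissible_flow L d cap lam f \<and> (\<forall>c. r $ c \<le> inflow L f (d c) c)"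
  then obtain f where "admissible_flow L d cap lam f" "\<And>c. r $ c \<le> inflow L f (d c) c"
    by blast
  then obtain g where g: "admissible_flow L d cap lam g" and rate: "\<And>c. inflow L g (d c) c = r $ c"
    using admissible_flow_scale[of L d cap lam f "\<lambda>c. r $ c"] lam_nonneg r by metis
  interpret fluid_network L d cap lam g by unfold_locales (rule g)
  have "r \<in> achievable L d cap M A"
    unfolding achievable_def using control_policy_fluid_policy throughput_fluid_policy[OF g] rate
    by (auto intro!: exI[of _ "fluid_policy L d g"])
  then show "r \<in> throughput_region L d cap M A"
    unfolding throughput_region_def by (rule closure_subset[THEN subsetD])
qed

end
section \<open>The throughput region\<close>

theorem lemma1:
  fixes L :: "('n::finite \<times> 'n) set"
    and d :: "'c::finite \<Rightarrow> 'n"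
    and cap :: "'n \<Rightarrow> 'n \<Rightarrow> real"
    and M :: "'w measure"
    and A :: "'n \<Rightarrow> 'c \<Rightarrow> nat \<Rightarrow> 'w \<Rightarrow> nat"
    and Amax :: nat
    and lam :: "'n \<Rightarrow> 'c \<Rightarrow> real"
    and r :: "real ^ 'c"
  assumes "prob_space M"
    and "\<And>n c t w. w \<in> space M \<Longrightarrow> A n c t w \<le> Amax"
    and "\<And>c t w. w \<in> space M \<Longrightarrow> A (d c) c t w = 0"
    and "prob_space.indep_vars M (\<lambda>_. count_space UNIV) (\<lambda>(n, c, t). A n c t)
           {(n, c, t). n \<noteq> d c}"
    and "\<And>n c s t. n \<noteq> d c \<Longrightarrow>
           distr M (count_space UNIV) (A n c s) = distr M (count_space UNIV) (A n c t)"
    and "\<And>n c t. prob_space.expectation M (\<lambda>w. real (A n c t w)) = lam n c"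
    and "\<And>c. 0 \<le> r $ c"
  shows "r \<in> throughput_region L d cap M A \<longleftrightarrow>
    (\<exists>(f :: 'n \<Rightarrow> 'n \<Rightarrow> 'c \<Rightarrow> real) (q :: 'n \<Rightarrow> 'c \<Rightarrow> real).
      (\<forall>c. \<forall>(a, b) \<in> L. 0 \<le> f a b c) \<and>
      (\<forall>c n. n \<noteq> d c \<longrightarrow> 0 \<le> q n c) \<and>
      (\<forall>c n. n \<noteq> d c \<longrightarrow>
         lam n c + (\<Sum>a | (a, n) \<in> L. f a n c) = q n c + (\<Sum>b | (n, b) \<in> L. f n b c)) \<and>
      (\<forall>(a, b) \<in> L. (\<Sum>c\<in>UNIV. f a b c) \<le> cap a b) \<and>
      (\<forall>c. r $ c \<le> (\<Sum>a | (a, d c) \<in> L. f a (d c) c) \<and>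
           (\<Sum>a | (a, d c) \<in> L. f a (d c) c) = (\<Sum>n | n \<noteq> d c. lam n c) - (\<Sum>n | n \<noteq> d c. q n c)))"
proof -
  interpret bounded_independent_arrivals M A d Amax lam
    by (rule bounded_independent_arrivals.intro[OF assms(1)])
      (unfold_locales, use assms(2-6) in auto)
  show ?thesis
    unfolding flow_with_overflow_iff_admissible_flow
    by (rule throughput_region_iff_admissible_flow) (rule assms(7))
qed

end
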